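(* For any $k\ge1$ and given indices $\mathbf{i}=(i_1,\dots,i_k)$ and $\mathbf{j}=(j_1,\dots,j_k)$, where $i_1,\dots,i_k,j_1,\dots,j_k\in\{1,2,\dots,N\}$, $$\int_{g\in S_N}[g_{i_1j_1}]\cdots[g_{i_kj_k}]\,dg=\sum_{\sigma,\tau\in\mathcal{P}(k)}\mathring{\mathrm{Wg}}_k(\sigma,\tau,N)\,\zeta(\sigma,\Pi_{\mathbf{i}})\,\zeta(\tau,\Pi_{\mathbf{j}}),$$ where $$\mathring{\mathrm{Wg}}_k(\sigma,\tau,N)=\sum_{i=0}^{|D(\sigma\vee\tau)|}\binom{|D(\sigma\vee\tau)|}{i}(-1)^i\sum_{\substack{\pi\in\mathcal{P}(k)\\ \pi\le\sigma\wedge\tau}}\mu(\pi,\sigma)\,\mu(\pi,\tau)\,N^{-i}\,\frac{1}{(N)_{\#\pi-i}}.$$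
   Context: An element $g$ of the symmetric group $S_N$ is identified with its $N\times N$ permutation matrix: $g_{rs}=1$ if $g(r)=s$ and $g_{rs}=0$ otherwise. The integral is over the normalized Haar measure on $S_N$: $\int_{g\in S_N} f(g)\,dg=\frac{1}{N!}\sum_{g\in S_N}f(g)$. The centered entries are $[g_{ij}]=g_{ij}-\frac1N$. $\mathcal{P}(k)$ is the lattice of set partitions of $[k]=\{1,\dots,k\}$, ordered by refinement: $\pi_1\le\pi_2$ iff every block of $\pi_1$ is contained in a block of $\pi_2$; $\wedge$ and $\vee$ are the greatest lower bound (meet) and least upper bound (join). $\#\pi$ is the number of blocks of $\pi$, and $D(\pi)=\{j\in[k]:\{j\}\text{ is a block of }\pi\}$. $\zeta(\pi_1,\pi_2)=1$ if $\pi_1\le\pi_2$ and $0$ otherwise. For $\pi_1\le\pi_2$, if the blocks $B_1,\dots,B_r$ of $\pi_2$ are split into $\lambda_1,\dots,\lambda_r$ blocks of $\pi_1$ respectively, then $\mu(\pi_1,\pi_2)=\prod_{i=1}^{r}(-1)^{\lambda_i-1}(\lambda_i-1)!$ (the Möbius function of $\mathcal{P}(k)$). For a multi-index $\mathbf{i}=(i_1,\dots,i_k)$, $\Pi_{\mathbf{i}}\in\mathcal{P}(k)$ is the partition in which $l,m$ lie in the same block iff $i_l=i_m$. $(x)_n=x(x-1)\cdots(x-n+1)$ is the falling factorial, with $(x)_0=1$. *)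

theory Defs
  imports
    Complex_Main
    "HOL-Library.Disjoint_Sets"
    "HOL-Combinatorics.Permutations"
    "HOL-Algebra.Complete_Lattice"
begin

subsection \<open>The lattice of set partitions of \<open>{1..k}\<close>\<close>

definition partition_lattice :: "nat \<Rightarrow> nat set set gorder" where
  "partition_lattice k =
     \<lparr>carrier = {\<pi>. partition_on {1..k} \<pi>}, eq = (=), le = refines {1..k}\<rparr>"

lemma partial_order_partition_lattice: "partial_order (partition_lattice k)"
  apply unfold_locales
  apply (simp_all add: partition_lattice_def refines_refl)
  apply (blast dest: refines_asym)
  apply (blast intro: refines_trans)
  done

text \<open>By the following lemma the meet and join of \<^theory>\<open>HOL-Algebra.Lattice\<close>, which are defined by
  choice of a greatest lower and a least upper bound, are the intended ones.\<close>

lemma complete_lattice_partition_lattice: "complete_lattice (partition_lattice k)"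
proof -
  interpret partial_order "partition_lattice k"
    by (rule partial_order_partition_lattice)
  show ?thesis
  proof (rule complete_lattice_criterion1)
    have "greatest (partition_lattice k) ({{1..k}} - {{}}) (carrier (partition_lattice k))"
    proof -
      have 1: "partition_on {1..k} ({{1..k}} - {{}})"
        by (auto simp: partition_on_def disjoint_def)
      have "refines {1..k} \<pi> ({{1..k}} - {{}})" if "partition_on {1..k} \<pi>" for \<pi>
        unfolding refines_def
      proof (intro conjI ballI that 1)
        fix X assume "X \<in> \<pi>"
        then have "X \<noteq> {}" "X \<subseteq> {1..k}"
          using partition_onD1[OF that] partition_onD3[OF that] by auto
        then show "\<exists>Y\<in>{{1..k}} - {{}}. X \<subseteq> Y" by auto
      qed
      with 1 show ?thesis by (simp add: partition_lattice_def greatest_def)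
    qed
    then show "\<exists>g. greatest (partition_lattice k) g (carrier (partition_lattice k))" ..
  next
    fix A
    assume A: "A \<subseteq> carrier (partition_lattice k)" and ne: "A \<noteq> {}"
    have part: "partition_on {1..k} P" if "P \<in> A" for P
      using A that by (auto simp: partition_lattice_def)
    define r where "r = (\<Inter>P\<in>A. {(x, y). \<exists>p\<in>P. x \<in> p \<and> y \<in> p})"
    have eqv: "equiv {1..k} {(x, y). \<exists>p\<in>P. x \<in> p \<and> y \<in> p}" if "P \<in> A" for P
      using equiv_partition_on[OF part[OF that]] .
    have r: "equiv {1..k} r"
    proof (rule equivI)
      show "r \<subseteq> {1..k} \<times> {1..k}"
        proof -
        obtain P where P: "P \<in> A" using ne by blast
        then have "r \<subseteq> {(x, y). \<exists>p\<in>P. x \<in> p \<and> y \<in> p}" unfolding r_def by blast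
        also have "\<dots> \<subseteq> {1..k} \<times> {1..k}"
          using eqv[OF P] by (simp only: equiv_def)
        finally show ?thesis .
      qed
      show "refl_on {1..k} r"
        using eqv by (simp add: r_def refl_on_def equiv_def)
      show "sym r"
        unfolding r_def by (auto simp: sym_def)
      show "trans r"
      proof (rule transI)
        fix x y z assume *: "(x, y) \<in> r" "(y, z) \<in> r"
        have "(x, z) \<in> {(x, y). \<exists>p\<in>P. x \<in> p \<and> y \<in> p}" if "P \<in> A" for P
        proof (rule transD)
          show "trans {(x, y). \<exists>p\<in>P. x \<in> p \<and> y \<in> p}"
            using eqv[OF that] by (simp only: equiv_def)
          show "(x, y) \<in> {(x, y). \<exists>p\<in>P. x \<in> p \<and> y \<in> p}"
            "(y, z) \<in> {(x, y). \<exists>p\<in>P. x \<in> p \<and> y \<in> p}"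
            using * that unfolding r_def by blast+
        qed
        then show "(x, z) \<in> r" unfolding r_def by blast
      qed
    qed
    have P1: "partition_on {1..k} ({1..k} // r)"
      by (rule partition_on_quotient[OF r])
    have "refines {1..k} ({1..k} // r) P" if P: "P \<in> A" for P
      unfolding refines_def
    proof (intro conjI ballI P1 part[OF P])
      fix X assume "X \<in> {1..k} // r"
      then obtain x where x: "x \<in> {1..k}" "X = r `` {x}" by (auto simp: quotient_def)
      from x(1) partition_onD1[OF part[OF P]] obtain p where p: "p \<in> P" "x \<in> p" by blast
      have "X \<subseteq> p"
      proof
        fix y assume "y \<in> X"
        then obtain q where "q \<in> P" "x \<in> q" "y \<in> q"
          using x(2) P by (auto simp: r_def)
        with p partition_onD2[OF part[OF P]] show "y \<in> p"
          by (auto simp: disjoint_def)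
      qed
      with p show "\<exists>Y\<in>P. X \<subseteq> Y" by blast
    qed
    moreover have "refines {1..k} Q ({1..k} // r)"
      if Q: "partition_on {1..k} Q" and lb: "\<And>P. P \<in> A \<Longrightarrow> refines {1..k} Q P" for Q
      unfolding refines_def
    proof (intro conjI ballI P1 Q)
      fix X assume X: "X \<in> Q"
      then have "X \<noteq> {}" and sub: "X \<subseteq> {1..k}"
        using partition_onD3[OF Q] partition_onD1[OF Q] by auto
      then obtain x where x: "x \<in> X" by blast
      have "X \<subseteq> r `` {x}"
      proof
        fix y assume y: "y \<in> X"
        have "\<exists>p\<in>P. x \<in> p \<and> y \<in> p" if "P \<in> A" for P
          using lb[OF that] X x y unfolding refines_def by blast
        then show "y \<in> r `` {x}" by (auto simp: r_def)
      qed
      moreover have "r `` {x} \<in> {1..k} // r"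
        using x sub by (auto simp: quotient_def)
      ultimately show "\<exists>Y\<in>{1..k} // r. X \<subseteq> Y" by blast
    qed
    ultimately have "greatest (partition_lattice k) ({1..k} // r) (Lower (partition_lattice k) A)"
      using A P1
      by (auto simp: partition_lattice_def greatest_def Lower_def)
    then show "\<exists>i. greatest (partition_lattice k) i (Lower (partition_lattice k) A)" ..
  qed
qed

definition singleton_elems :: "nat \<Rightarrow> nat set set \<Rightarrow> nat set" where
  "singleton_elems k \<pi> = {j \<in> {1..k}. {j} \<in> \<pi>}"

definition zeta :: "nat \<Rightarrow> nat set set \<Rightarrow> nat set set \<Rightarrow> real" where
  "zeta k \<pi>\<^sub>1 \<pi>\<^sub>2 = (if refines {1..k} \<pi>\<^sub>1 \<pi>\<^sub>2 then 1 else 0)"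

definition moebius :: "nat \<Rightarrow> nat set set \<Rightarrow> nat set set \<Rightarrow> real" where
  "moebius k \<pi>\<^sub>1 \<pi>\<^sub>2 =
     (if refines {1..k} \<pi>\<^sub>1 \<pi>\<^sub>2
      then \<Prod>B\<in>\<pi>\<^sub>2. let n = card {C \<in> \<pi>\<^sub>1. C \<subseteq> B} in (- 1) ^ (n - 1) * fact (n - 1)
      else 0)"

text \<open>A multi-index is a function of which only the values on \<open>{1..k}\<close> are used.\<close>

definition index_partition :: "nat \<Rightarrow> (nat \<Rightarrow> nat) \<Rightarrow> nat set set" where
  "index_partition k i = (\<lambda>l. {m \<in> {1..k}. i m = i l}) ` {1..k}"

subsection \<open>Centered integrals over the symmetric group\<close>

definition perm_matrix_entry :: "(nat \<Rightarrow> nat) \<Rightarrow> nat \<Rightarrow> nat \<Rightarrow> real" where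
  "perm_matrix_entry g r s = (if g r = s then 1 else 0)"

definition centered_entry :: "nat \<Rightarrow> (nat \<Rightarrow> nat) \<Rightarrow> nat \<Rightarrow> nat \<Rightarrow> real" where
  "centered_entry N g r s = perm_matrix_entry g r s - 1 / real N"

definition haar_integral_sym :: "nat \<Rightarrow> ((nat \<Rightarrow> nat) \<Rightarrow> real) \<Rightarrow> real" where
  "haar_integral_sym N f = 1 / fact N * (\<Sum>g | g permutes {1..N}. f g)"

definition falling_factorial :: "real \<Rightarrow> nat \<Rightarrow> real" where
  "falling_factorial x n = (\<Prod>m<n. x - real m)"

text \<open>In the sum below \<open>\<pi>\<close> refines \<open>\<sigma>\<close> and \<open>\<tau>\<close>. An element that is a singleton block of
  \<open>\<sigma> \<or> \<tau>\<close> is therefore also a singleton block of \<open>\<pi>\<close>, so \<open>i \<le> card \<pi>\<close> and the subtraction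
  \<open>card \<pi> - i\<close> never truncates. When \<open>card \<pi> - i > N\<close> the falling factorial vanishes and
  \<open>1 / 0 = 0\<close> removes the term.\<close>

definition centered_Wg :: "nat \<Rightarrow> nat set set \<Rightarrow> nat set set \<Rightarrow> nat \<Rightarrow> real" where
  "centered_Wg k \<sigma> \<tau> N =
     (let d = card (singleton_elems k (\<sigma> \<squnion>\<^bsub>partition_lattice k\<^esub> \<tau>)) in
      \<Sum>i = 0..d. real (d choose i) * (- 1) ^ i *
        (\<Sum>\<pi> | partition_on {1..k} \<pi> \<and> refines {1..k} \<pi> (\<sigma> \<sqinter>\<^bsub>partition_lattice k\<^esub> \<tau>).
           moebius k \<pi> \<sigma> * moebius k \<pi> \<tau> * real N powi (- int i)
             * (1 / falling_factorial (real N) (card \<pi> - i))))"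

end

theory Submission
  imports Defs
begin

text \<open>
  Expanding \<open>\<Prod>\<^sub>l (g\<^bsub>i l, j l\<^esub> - 1/N)\<close> over the set \<open>T\<close> of factors in which the constant is chosen
  reduces the left-hand side to ordinary moments over the complement of \<open>T\<close>, weighted by
  \<open>(-1/N)^card T\<close>. An ordinary moment is elementary: a product of matrix entries is the indicator of
  \<open>g (i l) = j l\<close> for all \<open>l\<close>. This is satisfiable iff \<open>i\<close> and \<open>j\<close> have the same coincidences, and
  then it prescribes an injection on the \<open>m\<close> distinct values of \<open>i\<close>, which \<open>(N - m)!\<close> permutations
  extend (\<open>haar_integral_prod_perm_matrix_entry\<close>).

  On the right-hand side the binomial sum in the Weingarten function is a sum over all subsets \<open>T\<close> of
  the singleton blocks of \<open>\<sigma> \<or> \<tau>\<close>, that is, over the sets \<open>T\<close> all of whose points are singleton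
  blocks of both \<open>\<sigma>\<close> and \<open>\<tau>\<close> (\<open>centered_Wg_eq_sum_subsets\<close>). For fixed \<open>T\<close> this condition is
  absorbed into the multi-indices: replacing the values of \<open>i\<close> on \<open>T\<close> by new, pairwise distinct ones
  gives a multi-index \<open>i\<^sub>T\<close>, and \<open>\<sigma> \<le> \<Pi>\<^bsub>i\<^sub>T\<^esub>\<close> says exactly that \<open>\<sigma> \<le> \<Pi>\<^sub>i\<close> and that \<open>T\<close> consists
  of singleton blocks of \<open>\<sigma>\<close> (\<open>zeta_isolate\<close>). The sums over \<open>\<sigma>\<close> and \<open>\<tau>\<close> now separate, and Moebius
  inversion \<open>(\<Sum>\<sigma>. \<mu>(\<pi>, \<sigma>) \<zeta>(\<sigma>, \<rho>)) = [\<pi> = \<rho>]\<close> (\<open>sum_moebius_zeta\<close>) forces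
  \<open>\<pi> = \<Pi>\<^bsub>i\<^sub>T\<^esub> = \<Pi>\<^bsub>j\<^sub>T\<^esub>\<close>. What remains for each \<open>T\<close> is the ordinary moment over its complement.

  Since \<open>\<mu>\<close> is given by an explicit product, its inversion property has to be derived. The partitions
  coarser than \<open>\<pi>\<close> are the partitions of the set of blocks of \<open>\<pi>\<close>, and being finer than \<open>\<Pi>\<^sub>h\<close>
  means that \<open>h\<close> is constant on blocks. This leaves a weighted count of the monochromatic partitions
  of a coloured set, which is evaluated by adding one point at a time
  (\<open>sum_monochromatic_partitions\<close>).
\<close>

section \<open>Weighted sums over monochromatic partitions\<close>

text \<open>The number of cyclic permutations of \<open>n\<close> points, multiplied by their sign; equivalently the Moebius
  function of the lattice of partitions of \<open>n\<close> points between its bottom and its top, for \<open>n \<ge> 1\<close>.\<close>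

definition cycle_weight :: "nat \<Rightarrow> real" where
  "cycle_weight n = (- 1) ^ (n - 1) * fact (n - 1)"

definition monochromatic :: "('a \<Rightarrow> 'c) \<Rightarrow> 'a set set \<Rightarrow> bool" where
  "monochromatic h P \<longleftrightarrow> (\<forall>B\<in>P. \<forall>x\<in>B. \<forall>y\<in>B. h x = h y)"

lemma monochromaticI:
  "(\<And>B x y. B \<in> P \<Longrightarrow> x \<in> B \<Longrightarrow> y \<in> B \<Longrightarrow> h x = h y) \<Longrightarrow> monochromatic h P"
  unfolding monochromatic_def by (intro ballI)

lemma monochromaticD:
  "monochromatic h P \<Longrightarrow> B \<in> P \<Longrightarrow> x \<in> B \<Longrightarrow> y \<in> B \<Longrightarrow> h x = h y"
  unfolding monochromatic_def by blast

lemma block_eqI: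
  assumes "partition_on A P" "B \<in> P" "C \<in> P" "x \<in> B" "x \<in> C"
  shows "B = C"
  using assms unfolding partition_on_def disjoint_def by blast

text \<open>In a partition of \<open>insert x A\<close> the point \<open>x\<close> is either alone or was added to a block of a partition
  of \<open>A\<close>. Letting \<open>C\<close> range over \<open>insert {} P\<close> treats both cases alike: the empty set is not a block,
  so removing it from \<open>P\<close> changes nothing, and \<open>insert x {}\<close> is the singleton.\<close>

lemma sum_partitions_insert:
  fixes F :: "'a set set \<Rightarrow> real"
  assumes fin: "finite A" and x: "x \<notin> A"
  shows "(\<Sum>Q | partition_on (insert x A) Q. F Q) =
    (\<Sum>P | partition_on A P. \<Sum>C\<in>insert {} P. F (insert (insert x C) (P - {C})))"
proof -
  let ?S = "Sigma {P. partition_on A P} (\<lambda>P. insert {} P)"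
  let ?B = "\<lambda>Q. \<Union>{B \<in> Q. x \<in> B}"
  let ?enc = "\<lambda>(P, C). insert (insert x C) (P - {C})"
  let ?dec = "\<lambda>Q. (insert (?B Q - {x}) (Q - {?B Q}) - {{}}, ?B Q - {x})"
  have "(\<Sum>P | partition_on A P. \<Sum>C\<in>insert {} P. F (insert (insert x C) (P - {C}))) =
      (\<Sum>(P, C)\<in>?S. F (insert (insert x C) (P - {C})))"
    using finitely_many_partition_on[OF fin] finite_elements[OF fin]
    by (intro sum.Sigma) auto
  also have "\<dots> = (\<Sum>Q | partition_on (insert x A) Q. F Q)"
  proof (rule sum.reindex_bij_witness[where j = ?enc and i = ?dec])
    fix a assume "a \<in> ?S"
    then obtain P C where a: "a = (P, C)" and P: "partition_on A P" and C: "C = {} \<or> C \<in> P"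
      by auto
    let ?Q = "insert (insert x C) (P - {C})"
    have ne: "{} \<notin> P" and sub: "\<And>B. B \<in> P \<Longrightarrow> B \<subseteq> A" and AU: "A = \<Union>P"
      using P by (auto simp: partition_on_def)
    then have xP: "\<And>B. B \<in> P \<Longrightarrow> x \<notin> B" using x by auto
    have xC: "x \<notin> C" using C xP by auto
    have eq: "{B \<in> ?Q. x \<in> B} = {insert x C}" using xP by auto
    have nin: "insert x C \<notin> P - {C}" using xP by auto
    have "insert x C - {x} = C" using xC by auto
    moreover have "insert C (P - {C}) - {{}} = P" using C ne by auto
    ultimately show "?dec (?enc a) = a"
      unfolding a prod.case eq using nin by simp
    have "disjnt (insert x C) (\<Union>(P - {C}))"
      using block_eqI[OF P] C xP by (auto simp: disjnt_def)
    moreover have "partition_on (insert x A - insert x C) (P - {C})"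
    proof (rule partition_onI)
      show "\<Union>(P - {C}) = insert x A - insert x C"
        using C xP block_eqI[OF P] x unfolding AU by auto
      show "disjnt p q" if "p \<in> P - {C}" "q \<in> P - {C}" "p \<noteq> q" for p q
        using that P by (auto simp: partition_on_def disjoint_def disjnt_def)
    qed (use ne in auto)
    ultimately have "partition_on (insert x A) ?Q"
      using C sub by (subst partition_on_insert) auto
    then show "?enc a \<in> {Q. partition_on (insert x A) Q}"
      by (simp add: a)
    show "F (?enc a) =
        (case a of (P, C) \<Rightarrow> F (insert (insert x C) (P - {C})))"
      by (simp add: a)
  next
    fix Q assume "Q \<in> {Q. partition_on (insert x A) Q}"
    then have Q: "partition_on (insert x A) Q" by simp
    then obtain B where B: "B \<in> Q" "x \<in> B" by (auto simp: partition_on_def)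
    have ne: "{} \<notin> Q" and sub: "\<And>B. B \<in> Q \<Longrightarrow> B \<subseteq> insert x A" and AU: "insert x A = \<Union>Q"
      using Q by (auto simp: partition_on_def)
    have "{B \<in> Q. x \<in> B} = {B}" using block_eqI[OF Q] B by auto
    then have eq: "?B Q = B" by simp
    have other: "C \<inter> B = {}" if "C \<in> Q" "C \<noteq> B" for C
      using block_eqI[OF Q] that B(1) by auto
    let ?C = "B - {x}" and ?P = "insert (B - {x}) (Q - {B}) - {{}}"
    have nin: "?C \<notin> Q - {B}" if "?C \<noteq> {}" using other[of ?C] that by blast
    have insC: "insert x ?C = B" using B by auto
    have rest: "?P - {?C} = Q - {B}"
    proof (cases "?C = {}")
      case True
      show ?thesis unfolding True using ne by auto
    next
      case False
      then show ?thesis using nin[OF False] ne by auto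
    qed
    show "?enc (?dec Q) = Q"
      unfolding eq prod.case insC rest using B by auto
    have "partition_on A ?P"
    proof (rule partition_onI)
      have "A = insert x A - {x}" using x by auto
      also have "\<dots> = \<Union>?P" unfolding AU using other B by auto
      finally show "\<Union>?P = A" ..
      show "disjnt p q" if pq: "p \<in> ?P" "q \<in> ?P" "p \<noteq> q" for p q
      proof -
        have C: "?C \<inter> D = {}" if "D \<in> Q - {B}" for D
          using other[of D] that by blast
        have "p = ?C \<or> p \<in> Q - {B}" "q = ?C \<or> q \<in> Q - {B}" using pq(1,2) by simp_all
        then consider "p = ?C" "q \<in> Q - {B}" | "p \<in> Q - {B}" "q = ?C" | "p \<in> Q" "q \<in> Q"
          using pq(3) by auto
        then have "p \<inter> q = {}"
        proof cases
          case 1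
          then show ?thesis using C by simp
        next
          case 2
          then show ?thesis using C by (simp add: Int_commute)
        next
          case 3
          then show ?thesis using disjointD[OF partition_onD2[OF Q]] pq(3) by simp
        qed
        then show ?thesis by (simp add: disjnt_def)
      qed
    qed auto
    then show "?dec Q \<in> ?S"
      unfolding eq by auto
  qed
  finally show ?thesis ..
qed

text \<open>Adding \<open>x\<close> to a block of size \<open>c\<close> multiplies its weight by \<open>-c\<close>, and making \<open>x\<close> a block of its own
  leaves the product unchanged. The blocks that \<open>x\<close> may join are those of its own colour; together
  they contain every earlier point of that colour, so a new point \<open>x\<close> multiplies the sum by
  \<open>1 - card {a \<in> A. h a = h x}\<close>. The first repetition of a colour makes this factor zero.\<close>

lemma sum_monochromatic_partitions:
  fixes h :: "'a \<Rightarrow> 'c"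
  assumes "finite A"
  shows "(\<Sum>P | partition_on A P. if monochromatic h P then \<Prod>B\<in>P. cycle_weight (card B) else 0)
    = (if inj_on h A then 1 else 0)"
  using assms
proof (induction A rule: finite_induct)
  case empty
  then show ?case by (simp add: partition_on_empty monochromatic_def)
next
  case (insert x A)
  let ?F = "\<lambda>P. if monochromatic h P then \<Prod>B\<in>P. cycle_weight (card B) else 0"
  let ?m = "card {a \<in> A. h a = h x}"
  have step: "(\<Sum>C\<in>insert {} P. ?F (insert (insert x C) (P - {C}))) = ?F P * (1 - real ?m)"
    if P: "partition_on A P" for P
  proof (cases "monochromatic h P")
    case False
    \<comment> \<open>deleting \<open>x\<close> from a monochromatic partition leaves a monochromatic one\<close>
    have "\<not> monochromatic h (insert (insert x C) (P - {C}))" for C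
      using False unfolding monochromatic_def by fastforce
    then show ?thesis using False by simp
  next
    case True
    have finP: "finite P" using finite_elements[OF insert.hyps(1) P] .
    have ne: "{} \<notin> P" and AU: "A = \<Union>P" using P by (auto simp: partition_on_def)
    have finB: "finite C" if "C \<in> P" for C
      using that AU insert.hyps(1) by (auto intro: finite_subset)
    let ?W = "\<Prod>B\<in>P. cycle_weight (card B)"
    have xP: "insert x C \<notin> P" for C using AU insert.hyps(2) by auto
    have "monochromatic h (insert {x} P)" using True unfolding monochromatic_def by blast
    then have sing: "?F (insert (insert x {}) (P - {{}})) = ?W"
      using xP[of "{}"] ne finP by (simp add: cycle_weight_def)
    have block: "?F (insert (insert x C) (P - {C})) =
        - ?W * (if \<forall>a\<in>C. h a = h x then real (card C) else 0)" if C: "C \<in> P" for C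
    proof -
      have "C \<noteq> {}" using C ne by auto
      then have c: "card C > 0" using finB[OF C] by (simp add: card_gt_0_iff)
      have xC: "x \<notin> C" using C AU insert.hyps(2) by auto
      have mono: "monochromatic h (insert (insert x C) (P - {C})) \<longleftrightarrow> (\<forall>a\<in>C. h a = h x)"
      proof
        assume mono: "monochromatic h (insert (insert x C) (P - {C}))"
        show "\<forall>a\<in>C. h a = h x" using monochromaticD[OF mono insertI1] by simp
      next
        assume *: "\<forall>a\<in>C. h a = h x"
        have new: "h y = h z" if "y \<in> insert x C" "z \<in> insert x C" for y z
          using * that by (metis insertE)
        show "monochromatic h (insert (insert x C) (P - {C}))"
        proof (rule monochromaticI)
          fix B y z assume "B \<in> insert (insert x C) (P - {C})" "y \<in> B" "z \<in> B"
          then show "h y = h z" using new monochromaticD[OF True, of B y z] by (metis DiffD1 insertE)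
        qed
      qed
      obtain c' where c': "card C = Suc c'" using c by (cases "card C") auto
      have "(\<Prod>B\<in>insert (insert x C) (P - {C}). cycle_weight (card B)) =
          cycle_weight (Suc (card C)) * (\<Prod>B\<in>P - {C}. cycle_weight (card B))"
        using xP finP finB[OF C] xC by simp
      also have "cycle_weight (Suc (card C)) = - real (card C) * cycle_weight (card C)"
        by (simp add: cycle_weight_def c' algebra_simps)
      also have "- real (card C) * cycle_weight (card C) * (\<Prod>B\<in>P - {C}. cycle_weight (card B))
          = - real (card C) * ?W"
        using prod.remove[OF finP C, of "\<lambda>B. cycle_weight (card B)"] by simp
      finally show ?thesis unfolding mono by simp
    qed
    have "{a \<in> A. h a = h x} = \<Union>{C \<in> P. \<forall>a\<in>C. h a = h x}"
    proof (intro equalityI subsetI)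
      fix a assume "a \<in> {a \<in> A. h a = h x}"
      then obtain C where C: "C \<in> P" "a \<in> C" and a: "h a = h x" unfolding AU by auto
      have "\<forall>b\<in>C. h b = h x" using monochromaticD[OF True C(1) _ C(2)] a by simp
      then show "a \<in> \<Union>{C \<in> P. \<forall>a\<in>C. h a = h x}" using C by blast
    qed (use AU in blast)
    also have "card \<dots> = (\<Sum>C | C \<in> P \<and> (\<forall>a\<in>C. h a = h x). card C)"
      using P finB by (intro card_Union_disjoint)
        (auto simp: partition_on_def disjoint_def pairwise_def disjnt_def)
    finally have m: "real ?m = (\<Sum>C\<in>P. if \<forall>a\<in>C. h a = h x then real (card C) else 0)"
      using finP by (simp add: sum.inter_filter if_distrib[of real] cong: if_cong)
    have "(\<Sum>C\<in>insert {} P. ?F (insert (insert x C) (P - {C}))) = ?W +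
        (\<Sum>C\<in>P. - ?W * (if \<forall>a\<in>C. h a = h x then real (card C) else 0))"
      using sing finP ne block by (subst sum.insert) (auto intro!: sum.cong)
    also have "\<dots> = ?W * (1 - real ?m)"
      unfolding m sum_distrib_left[symmetric] by (simp add: algebra_simps)
    finally show ?thesis using True by simp
  qed
  have "(\<Sum>Q | partition_on (insert x A) Q. ?F Q) = (\<Sum>P | partition_on A P. ?F P * (1 - real ?m))"
    using sum_partitions_insert[OF insert.hyps, of ?F] step by simp
  also have "\<dots> = (if inj_on h A then 1 else 0) * (1 - real ?m)"
    by (simp only: sum_distrib_right[symmetric] insert.IH)
  also have "\<dots> = (if inj_on h (insert x A) then 1 else 0)"
  proof (cases "inj_on h A \<and> h x \<in> h ` A")
    case True
    then obtain a where a: "a \<in> A" "h a = h x" by auto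
    have "b = a" if "b \<in> A" "h b = h x" for b
      using inj_onD[of h A b a] True a that by simp
    then have "{a \<in> A. h a = h x} = {a}" using a by blast
    then show ?thesis using True insert.hyps by simp
  next
    case False
    then show ?thesis
    proof (cases "inj_on h A")
      case True
      then have "{a \<in> A. h a = h x} = {}" using False by (auto simp: image_iff)
      then have "?m = 0" by (metis card.empty)
      then show ?thesis using True False insert.hyps by simp
    qed simp
  qed
  finally show ?case .
qed

section \<open>Moebius inversion in the partition lattice\<close>

lemma blocks_subset_Union_eq:
  assumes \<pi>: "partition_on A \<pi>" and K: "K \<subseteq> \<pi>"
  shows "{C \<in> \<pi>. C \<subseteq> \<Union>K} = K"
proof -
  have "C \<in> K" if C: "C \<in> \<pi>" "C \<subseteq> \<Union>K" for C
  proof -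
    obtain x where "x \<in> C" using C partition_onD3[OF \<pi>] by fastforce
    then obtain D where "D \<in> K" "x \<in> D" using C by auto
    then show "C \<in> K" using block_eqI[OF \<pi> C(1), of D x] \<open>x \<in> C\<close> K by auto
  qed
  then show ?thesis using K by auto
qed

text \<open>The interval above \<open>\<pi>\<close> is the partition lattice of the set \<open>\<pi>\<close>: a coarser partition is determined
  by the way in which it groups the blocks of \<open>\<pi>\<close>.\<close>

lemma bij_betw_coarsenings:
  assumes \<pi>: "partition_on A \<pi>"
  shows "bij_betw ((`) Union) {P. partition_on \<pi> P} {\<sigma>. refines A \<pi> \<sigma>}"
proof (rule bij_betw_byWitness[where f' = "(`) (\<lambda>B. {C \<in> \<pi>. C \<subseteq> B})"])
  have ne: "{} \<notin> \<pi>" and AU: "A = \<Union>\<pi>" using \<pi> by (auto simp: partition_on_def)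
  note blocks = blocks_subset_Union_eq[OF \<pi>]
  show "\<forall>P\<in>{P. partition_on \<pi> P}. (\<lambda>B. {C \<in> \<pi>. C \<subseteq> B}) ` (Union ` P) = P"
  proof
    fix P assume "P \<in> {P. partition_on \<pi> P}"
    then have "K \<subseteq> \<pi>" if "K \<in> P" for K using that by (auto simp: partition_on_def)
    then show "(\<lambda>B. {C \<in> \<pi>. C \<subseteq> B}) ` (Union ` P) = P"
      using blocks by (simp add: image_image)
  qed
  have union: "\<Union>{C \<in> \<pi>. C \<subseteq> B} = B" if "refines A \<pi> \<sigma>" "B \<in> \<sigma>" for \<sigma> B
    using refines_obtains_subset[OF that] by (simp add: partition_on_def)
  then show "\<forall>\<sigma>\<in>{\<sigma>. refines A \<pi> \<sigma>}. Union ` (\<lambda>B. {C \<in> \<pi>. C \<subseteq> B}) ` \<sigma> = \<sigma>"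
    by (auto simp: image_image)
  show "(`) Union ` {P. partition_on \<pi> P} \<subseteq> {\<sigma>. refines A \<pi> \<sigma>}"
  proof clarify
    fix P assume P: "partition_on \<pi> P"
    have KP: "K \<subseteq> \<pi>" if "K \<in> P" for K using P that by (auto simp: partition_on_def)
    have "partition_on A (Union ` P)"
    proof (rule partition_onI)
      show "\<Union>(Union ` P) = A" using P AU by (auto simp: partition_on_def)
      show "{} \<notin> Union ` P"
      proof
        assume "{} \<in> Union ` P"
        then obtain K where K: "K \<in> P" "\<Union>K = {}" by auto
        then obtain C where "C \<in> K" using partition_onD3[OF P] by fastforce
        then have "C = {}" "C \<in> \<pi>" using K KP by auto
        then show False using ne by simp
      qed
      show "disjnt p q" if pq: "p \<in> Union ` P" "q \<in> Union ` P" "p \<noteq> q" for p q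
      proof -
        obtain K L where KL: "K \<in> P" "p = \<Union>K" "L \<in> P" "q = \<Union>L" using pq by auto
        have "C = D" if "C \<in> K" "D \<in> L" "x \<in> C" "x \<in> D" for C D x
          using that block_eqI[OF \<pi>] KP KL by blast
        moreover have "K \<inter> L = {}" using KL \<open>p \<noteq> q\<close> block_eqI[OF P] by blast
        ultimately show ?thesis unfolding KL disjnt_def by blast
      qed
    qed
    moreover have "\<exists>Y\<in>Union ` P. C \<subseteq> Y" if "C \<in> \<pi>" for C
      using P that by (auto simp: partition_on_def)
    ultimately show "refines A \<pi> (Union ` P)" using \<pi> by (simp add: refines_def)
  qed
  show "(`) (\<lambda>B. {C \<in> \<pi>. C \<subseteq> B}) ` {\<sigma>. refines A \<pi> \<sigma>} \<subseteq> {P. partition_on \<pi> P}"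
  proof clarify
    fix \<sigma> assume \<sigma>: "refines A \<pi> \<sigma>"
    then have part: "partition_on A \<sigma>" by (simp add: refines_def)
    show "partition_on \<pi> ((\<lambda>B. {C \<in> \<pi>. C \<subseteq> B}) ` \<sigma>)"
    proof (rule partition_onI)
      show "\<Union>((\<lambda>B. {C \<in> \<pi>. C \<subseteq> B}) ` \<sigma>) = \<pi>" using \<sigma> by (auto simp: refines_def)
      show "{} \<notin> (\<lambda>B. {C \<in> \<pi>. C \<subseteq> B}) ` \<sigma>"
      proof
        assume "{} \<in> (\<lambda>B. {C \<in> \<pi>. C \<subseteq> B}) ` \<sigma>"
        then obtain B where B: "B \<in> \<sigma>" "{C \<in> \<pi>. C \<subseteq> B} = {}" by blast
        then have "B = {}" using union[OF \<sigma> B(1)] unfolding B(2) by simp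
        then show False using B(1) partition_onD3[OF part] by simp
      qed
      show "disjnt p q" if pq: "p \<in> (\<lambda>B. {C \<in> \<pi>. C \<subseteq> B}) ` \<sigma>" "q \<in> (\<lambda>B. {C \<in> \<pi>. C \<subseteq> B}) ` \<sigma>" "p \<noteq> q" for p q
      proof -
        obtain B D where BD: "B \<in> \<sigma>" "p = {C \<in> \<pi>. C \<subseteq> B}" "D \<in> \<sigma>" "q = {C \<in> \<pi>. C \<subseteq> D}"
          using pq by blast
        then have disj: "B \<inter> D = {}" using \<open>p \<noteq> q\<close> block_eqI[OF part, of B D] by blast
        have "C = {}" if "C \<in> p" "C \<in> q" for C using that disj unfolding BD(2,4) by blast
        moreover have "{} \<notin> p" unfolding BD(2) using ne by simp
        ultimately show ?thesis unfolding disjnt_def by blast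
      qed
    qed
  qed
qed

lemma partition_on_index_partition: "partition_on {1..k} (index_partition k h)"
  by (rule partition_onI) (auto simp: index_partition_def disjnt_def)

lemma refines_index_partition_iff:
  assumes "partition_on {1..k} \<sigma>"
  shows "refines {1..k} \<sigma> (index_partition k h) \<longleftrightarrow> monochromatic h \<sigma>"
proof
  assume ref: "refines {1..k} \<sigma> (index_partition k h)"
  have "h x = h y" if B: "B \<in> \<sigma>" "x \<in> B" "y \<in> B" for B x y
  proof -
    obtain Y where Y: "Y \<in> index_partition k h" "B \<subseteq> Y"
      using ref B(1) unfolding refines_def by blast
    then obtain l where "Y = {m \<in> {1..k}. h m = h l}" by (auto simp: index_partition_def)
    then have "h x = h l" "h y = h l" using Y B by auto
    then show ?thesis by simp
  qed
  then show "monochromatic h \<sigma>" unfolding monochromatic_def by blast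
next
  assume mono: "monochromatic h \<sigma>"
  have "\<exists>Y\<in>index_partition k h. X \<subseteq> Y" if X: "X \<in> \<sigma>" for X
  proof -
    obtain l where l: "l \<in> X" using X assms by (fastforce simp: partition_on_def)
    have sub: "X \<subseteq> {1..k}" using X assms by (auto simp: partition_on_def)
    then have "{m \<in> {1..k}. h m = h l} \<in> index_partition k h"
      using l by (auto simp: index_partition_def)
    moreover have "X \<subseteq> {m \<in> {1..k}. h m = h l}"
      using monochromaticD[OF mono X _ l] sub by blast
    ultimately show ?thesis by blast
  qed
  then show "refines {1..k} \<sigma> (index_partition k h)"
    using assms partition_on_index_partition by (auto simp: refines_def)
qed

text \<open>Here \<open>H\<close> is the colouring of the blocks of \<open>\<pi>\<close> that \<open>h\<close> induces when it is constant on each of them.\<close>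

lemma eq_index_partition_iff:
  assumes \<pi>: "partition_on {1..k} \<pi>" and H: "\<And>C x. C \<in> \<pi> \<Longrightarrow> x \<in> C \<Longrightarrow> h x = H C"
  shows "\<pi> = index_partition k h \<longleftrightarrow> inj_on H \<pi>"
proof
  assume eq: "\<pi> = index_partition k h"
  show "inj_on H \<pi>"
  proof (rule inj_onI)
    fix C D assume CD: "C \<in> \<pi>" "D \<in> \<pi>" "H C = H D"
    then obtain c d where cd: "c \<in> {1..k}" "C = {m \<in> {1..k}. h m = h c}"
      "d \<in> {1..k}" "D = {m \<in> {1..k}. h m = h d}"
      unfolding eq index_partition_def by auto
    then have "c \<in> C" "d \<in> D" by simp_all
    then have "h c = h d" using H[OF CD(1)] H[OF CD(2)] CD(3) by simp
    then show "C = D" using cd(2,4) by simp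
  qed
next
  assume inj: "inj_on H \<pi>"
  have mono: "monochromatic h \<pi>" using H by (auto simp: monochromatic_def)
  show "\<pi> = index_partition k h"
  proof (rule refines_asym)
    show "refines {1..k} \<pi> (index_partition k h)"
      using refines_index_partition_iff[OF \<pi>] mono by simp
    have "\<exists>C\<in>\<pi>. {m \<in> {1..k}. h m = h l} \<subseteq> C" if l: "l \<in> {1..k}" for l
    proof -
      have U: "{1..k} = \<Union>\<pi>" using \<pi> by (simp add: partition_on_def)
      then obtain C where C: "C \<in> \<pi>" "l \<in> C" using l by (metis UnionE)
      have "m \<in> C" if m: "m \<in> {1..k}" "h m = h l" for m
      proof -
        obtain D where D: "D \<in> \<pi>" "m \<in> D" using U m by (metis UnionE)
        then have "H C = H D" using H C m by metis
        then show ?thesis using inj_onD[OF inj] C D by auto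
      qed
      then show ?thesis using C by auto
    qed
    then show "refines {1..k} (index_partition k h) \<pi>"
      using \<pi> partition_on_index_partition unfolding refines_def by (auto simp: index_partition_def)
  qed
qed

text \<open>This is the defining property of the Moebius function. If \<open>\<pi>\<close> does not refine \<open>\<Pi>\<^sub>h\<close> then no \<open>\<sigma>\<close> lies
  between them. Otherwise \<open>h\<close> colours the blocks of \<open>\<pi>\<close>, each \<open>\<sigma>\<close> between \<open>\<pi>\<close> and \<open>\<Pi>\<^sub>h\<close> is a
  monochromatic partition of these blocks, \<open>\<mu>(\<pi>, \<sigma>)\<close> is its weight, and the colouring is injective
  exactly when \<open>\<pi> = \<Pi>\<^sub>h\<close>.\<close>

lemma sum_moebius_zeta:
  assumes \<pi>: "partition_on {1..k} \<pi>"
  shows "(\<Sum>\<sigma> | partition_on {1..k} \<sigma>. moebius k \<pi> \<sigma> * zeta k \<sigma> (index_partition k h)) =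
    (if \<pi> = index_partition k h then 1 else 0)"
proof (cases "monochromatic h \<pi>")
  case False
  then have "\<not> (refines {1..k} \<pi> \<sigma> \<and> refines {1..k} \<sigma> (index_partition k h))" for \<sigma>
    using refines_trans refines_index_partition_iff[OF \<pi>] by blast
  then have "moebius k \<pi> \<sigma> * zeta k \<sigma> (index_partition k h) = 0" for \<sigma>
    by (auto simp: moebius_def zeta_def)
  moreover have "\<pi> \<noteq> index_partition k h"
    using False refines_refl[OF \<pi>] refines_index_partition_iff[OF \<pi>] by auto
  ultimately show ?thesis by (simp only: sum.neutral_const if_False)
next
  case True
  have fin: "finite \<pi>" using finite_elements[OF _ \<pi>] by simp
  have ne: "{} \<notin> \<pi>" using \<pi> by (simp add: partition_on_def)
  define H where "H C = h (SOME x. x \<in> C)" for C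
  have H: "h x = H C" if "C \<in> \<pi>" "x \<in> C" for C x
    unfolding H_def by (rule monochromaticD[OF True that someI[of "\<lambda>x. x \<in> C", OF that(2)]])
  have bij: "bij_betw ((`) Union) {P. partition_on \<pi> P} {\<sigma>. refines {1..k} \<pi> \<sigma>}"
    by (rule bij_betw_coarsenings[OF \<pi>])
  have term_eq: "moebius k \<pi> (Union ` P) * zeta k (Union ` P) (index_partition k h) =
      (if monochromatic H P then \<Prod>K\<in>P. cycle_weight (card K) else 0)"
    if P: "partition_on \<pi> P" for P
  proof -
    have ref: "refines {1..k} \<pi> (Union ` P)" using bij P by (auto simp: bij_betw_def)
    then have part: "partition_on {1..k} (Union ` P)" by (simp add: refines_def)
    have KP: "K \<subseteq> \<pi>" if "K \<in> P" for K using P that by (auto simp: partition_on_def)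
    have blocks: "{C \<in> \<pi>. C \<subseteq> \<Union>K} = K" if "K \<in> P" for K
      using blocks_subset_Union_eq[OF \<pi> KP[OF that]] .
    then have inj: "inj_on Union P" by (rule inj_on_inverseI)
    have "moebius k \<pi> (Union ` P) = (\<Prod>K\<in>P. cycle_weight (card K))"
      using ref blocks by (simp add: moebius_def prod.reindex[OF inj] Let_def cycle_weight_def)
    moreover have "monochromatic h (Union ` P) \<longleftrightarrow> monochromatic H P"
    proof
      assume mono: "monochromatic h (Union ` P)"
      show "monochromatic H P"
      proof (rule monochromaticI)
        fix K C D assume K: "K \<in> P" "C \<in> K" "D \<in> K"
        then have CD: "C \<in> \<pi>" "D \<in> \<pi>" using KP by auto
        then obtain x y where xy: "x \<in> C" "y \<in> D" using ne by fastforce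
        then have "h x = h y" using K by (intro monochromaticD[OF mono, of "\<Union>K"]) auto
        then show "H C = H D" using H[OF CD(1) xy(1)] H[OF CD(2) xy(2)] by simp
      qed
    next
      assume mono: "monochromatic H P"
      show "monochromatic h (Union ` P)"
      proof (rule monochromaticI)
        fix B x y assume "B \<in> Union ` P" "x \<in> B" "y \<in> B"
        then obtain K C D where K: "K \<in> P" "C \<in> K" "D \<in> K" and xy: "x \<in> C" "y \<in> D" by auto
        then have CD: "C \<in> \<pi>" "D \<in> \<pi>" using KP by auto
        show "h x = h y"
          using monochromaticD[OF mono K] H[OF CD(1) xy(1)] H[OF CD(2) xy(2)] by simp
      qed
    qed
    ultimately show ?thesis
      unfolding zeta_def refines_index_partition_iff[OF part] by simp
  qed
  have "(\<Sum>\<sigma> | partition_on {1..k} \<sigma>. moebius k \<pi> \<sigma> * zeta k \<sigma> (index_partition k h)) =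
      (\<Sum>\<sigma> | refines {1..k} \<pi> \<sigma>. moebius k \<pi> \<sigma> * zeta k \<sigma> (index_partition k h))"
    by (rule sum.mono_neutral_right)
      (auto simp: finitely_many_partition_on moebius_def refines_def)
  also have "\<dots> = (\<Sum>P | partition_on \<pi> P.
      if monochromatic H P then \<Prod>K\<in>P. cycle_weight (card K) else 0)"
    unfolding sum.reindex_bij_betw[OF bij, symmetric] using term_eq by simp
  also have "\<dots> = (if inj_on H \<pi> then 1 else 0)"
    by (rule sum_monochromatic_partitions[OF fin])
  finally show ?thesis using eq_index_partition_iff[OF \<pi> H] by simp
qed

section \<open>Moments of permutation matrices\<close>

lemma fact_eq_falling_factorial:
  assumes "m \<le> N"
  shows "fact N = falling_factorial (real N) m * fact (N - m)"
  using assms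
proof (induction m)
  case 0
  then show ?case by (simp add: falling_factorial_def)
next
  case (Suc m)
  then have "N - m = Suc (N - Suc m)" by simp
  then have "(fact (N - m) :: real) = (real N - real m) * fact (N - Suc m)"
    using Suc.prems by (simp add: of_nat_diff)
  then show ?case using Suc by (simp add: falling_factorial_def)
qed

lemma permutes_extending_inj_on:
  assumes U: "finite U" "A \<subseteq> U" and f: "inj_on f A" "f ` A \<subseteq> U"
  obtains p where "p permutes U" "\<And>a. a \<in> A \<Longrightarrow> p a = f a"
proof -
  have fin: "finite A" using U finite_subset by blast
  have "card (U - A) = card (U - f ` A)"
    using U f fin by (simp add: card_Diff_subset card_image)
  then obtain q where q: "bij_betw q (U - A) (U - f ` A)"
    using U finite_same_card_bij by (metis finite_Diff)
  define p where "p x = (if x \<in> A then f x else if x \<in> U then q x else x)" for x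
  have "bij_betw p (A \<union> (U - A)) (f ` A \<union> (U - f ` A))"
  proof (rule bij_betw_combine)
    have "bij_betw f A (f ` A)" using f(1) by (simp add: bij_betw_def)
    then show "bij_betw p A (f ` A)" by (subst bij_betw_cong[of _ p f]) (auto simp: p_def)
    show "bij_betw p (U - A) (U - f ` A)"
      using q by (subst bij_betw_cong[of _ p q]) (auto simp: p_def)
  qed auto
  moreover have "A \<union> (U - A) = U" "f ` A \<union> (U - f ` A) = U" using U f by auto
  ultimately have "p permutes U" using U by (intro bij_imp_permutes) (auto simp: p_def)
  then show thesis using that by (simp add: p_def)
qed

text \<open>Composition with the inverse of one extension \<open>p\<close> identifies all extensions of \<open>f\<close> with the
  permutations that fix \<open>A\<close> pointwise.\<close>

lemma card_permutes_extending:
  assumes U: "finite U" "A \<subseteq> U" and f: "inj_on f A" "f ` A \<subseteq> U"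
  shows "card {g. g permutes U \<and> (\<forall>a\<in>A. g a = f a)} = fact (card U - card A)"
proof -
  obtain p where p: "p permutes U" "\<And>a. a \<in> A \<Longrightarrow> p a = f a"
    using permutes_extending_inj_on[OF assms] by blast
  have "bij_betw (\<lambda>q. p \<circ> q) {q. q permutes (U - A)} {g. g permutes U \<and> (\<forall>a\<in>A. g a = f a)}"
  proof (rule bij_betw_byWitness[where f' = "\<lambda>g. inv p \<circ> g"])
    show "\<forall>q\<in>{q. q permutes (U - A)}. inv p \<circ> (p \<circ> q) = q"
      using permutes_inv_o[OF p(1)] by (simp flip: o_assoc add: o_assoc)
    show "\<forall>g\<in>{g. g permutes U \<and> (\<forall>a\<in>A. g a = f a)}. p \<circ> (inv p \<circ> g) = g"
      using permutes_inv_o[OF p(1)] by (simp flip: o_assoc add: o_assoc)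
    show "(\<lambda>q. p \<circ> q) ` {q. q permutes (U - A)} \<subseteq> {g. g permutes U \<and> (\<forall>a\<in>A. g a = f a)}"
    proof clarify
      fix q assume q: "q permutes (U - A)"
      then have "q permutes U" by (rule permutes_subset) auto
      moreover have "q a = a" if "a \<in> A" for a using q that by (auto simp: permutes_def)
      ultimately show "(p \<circ> q) permutes U \<and> (\<forall>a\<in>A. (p \<circ> q) a = f a)"
        using p permutes_compose by auto
    qed
    show "(\<lambda>g. inv p \<circ> g) ` {g. g permutes U \<and> (\<forall>a\<in>A. g a = f a)} \<subseteq> {q. q permutes (U - A)}"
    proof clarify
      fix g assume g: "g permutes U" "\<forall>a\<in>A. g a = f a"
      have perm: "inv p \<circ> g permutes U" using permutes_compose[OF g(1) permutes_inv[OF p(1)]] .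
      have "(inv p \<circ> g) a = a" if "a \<in> A" for a
        using g(2) p(2)[OF that] that permutes_inverses(2)[OF p(1), of a] by simp
      then show "inv p \<circ> g permutes (U - A)"
        by (intro permutes_superset[OF perm]) blast
    qed
  qed
  then have "card {g. g permutes U \<and> (\<forall>a\<in>A. g a = f a)} = card {q. q permutes (U - A)}"
    by (simp add: bij_betw_same_card)
  also have "\<dots> = fact (card (U - A))"
    using U card_permutations by blast
  also have "card (U - A) = card U - card A"
    using U by (intro card_Diff_subset) (auto intro: finite_subset)
  finally show ?thesis .
qed

text \<open>The product is the indicator of \<open>g (i l) = j l\<close> for all \<open>l \<in> S\<close>. Since \<open>g\<close> is injective, this can
  only hold if \<open>i\<close> and \<open>j\<close> have the same coincidences on \<open>S\<close>; then \<open>i l \<mapsto> j l\<close> is a well-defined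
  injection on \<open>i ` S\<close>.\<close>

lemma haar_integral_prod_perm_matrix_entry:
  assumes S: "finite S" and i: "i ` S \<subseteq> {1..N}" and j: "j ` S \<subseteq> {1..N}"
  shows "haar_integral_sym N (\<lambda>g. \<Prod>l\<in>S. perm_matrix_entry g (i l) (j l)) =
    (if \<forall>l\<in>S. \<forall>m\<in>S. i l = i m \<longleftrightarrow> j l = j m
     then 1 / falling_factorial (real N) (card (i ` S)) else 0)"
proof -
  let ?G = "{g. g permutes {1..N} \<and> (\<forall>l\<in>S. g (i l) = j l)}"
  have fin: "finite {g. g permutes {1..N}}" by (simp add: finite_permutations)
  have "(\<Prod>l\<in>S. perm_matrix_entry g (i l) (j l)) = (if \<forall>l\<in>S. g (i l) = j l then 1 else 0)" for g
    using S by (auto simp: perm_matrix_entry_def prod_zero_iff)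
  then have "haar_integral_sym N (\<lambda>g. \<Prod>l\<in>S. perm_matrix_entry g (i l) (j l)) =
      real (card ?G) / fact N"
    using fin by (simp add: haar_integral_sym_def sum.inter_filter[symmetric] Collect_conj_eq[symmetric])
  also have "\<dots> = (if \<forall>l\<in>S. \<forall>m\<in>S. i l = i m \<longleftrightarrow> j l = j m
     then 1 / falling_factorial (real N) (card (i ` S)) else 0)"
  proof (cases "\<forall>l\<in>S. \<forall>m\<in>S. i l = i m \<longleftrightarrow> j l = j m")
    case True
    define f where "f a = j (inv_into S i a)" for a
    have fi: "f (i l) = j l" if "l \<in> S" for l
    proof -
      have "inv_into S i (i l) \<in> S" "i (inv_into S i (i l)) = i l"
        using that by (auto intro: inv_into_into f_inv_into_f)
      then show ?thesis using True that by (simp add: f_def)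
    qed
    then have "inj_on f (i ` S)" using True by (auto intro!: inj_onI)
    moreover have "f ` i ` S \<subseteq> {1..N}" using fi j by auto
    ultimately have "card {g. g permutes {1..N} \<and> (\<forall>a\<in>i ` S. g a = f a)} = fact (N - card (i ` S))"
      using card_permutes_extending[of "{1..N}" "i ` S" f] i by simp
    moreover have "?G = {g. g permutes {1..N} \<and> (\<forall>a\<in>i ` S. g a = f a)}" using fi by auto
    ultimately have card: "card ?G = fact (N - card (i ` S))" by simp
    have "card (i ` S) \<le> N" using card_mono[OF _ i] by simp
    then have "fact N = falling_factorial (real N) (card (i ` S)) * fact (N - card (i ` S))"
      by (rule fact_eq_falling_factorial)
    then show ?thesis using True card by simp
  next
    case False
    then obtain l m where lm: "l \<in> S" "m \<in> S" "(i l = i m) \<noteq> (j l = j m)" by blast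
    have "g \<notin> ?G" for g
    proof
      assume "g \<in> ?G"
      then have "inj g" "g (i l) = j l" "g (i m) = j m" using lm by (auto dest: permutes_inj)
      then show False using lm(3) by (metis injD)
    qed
    then have "card ?G = 0" by (metis (no_types, lifting) card.empty equals0I)
    then show ?thesis unfolding if_not_P[OF False] by simp
  qed
  finally show ?thesis .
qed

lemma haar_integral_sym_sum:
  "haar_integral_sym N (\<lambda>g. \<Sum>T\<in>A. c T * f T g) = (\<Sum>T\<in>A. c T * haar_integral_sym N (f T))"
proof -
  have "(\<Sum>g | g permutes {1..N}. \<Sum>T\<in>A. c T * f T g) =
      (\<Sum>T\<in>A. c T * (\<Sum>g | g permutes {1..N}. f T g))"
    unfolding sum_distrib_left by (rule sum.swap)
  then show ?thesis
    unfolding haar_integral_sym_def by (simp add: sum_distrib_left mult_ac)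
qed

lemma haar_integral_prod_centered_entry:
  fixes k :: nat and i j :: "nat \<Rightarrow> nat"
  shows "haar_integral_sym N (\<lambda>g. \<Prod>l = 1..k. centered_entry N g (i l) (j l)) =
    (\<Sum>T\<in>Pow {1..k}. (- (1 / real N)) ^ card T *
      haar_integral_sym N (\<lambda>g. \<Prod>l\<in>{1..k} - T. perm_matrix_entry g (i l) (j l)))"
proof -
  have "(\<Prod>l = 1..k. centered_entry N g (i l) (j l)) =
      (\<Sum>T\<in>Pow {1..k}. (- (1 / real N)) ^ card T * (\<Prod>l\<in>{1..k} - T. perm_matrix_entry g (i l) (j l)))" for g
    using prod_add[of "{1..k}" "\<lambda>_. - (1 / real N)" "\<lambda>l. perm_matrix_entry g (i l) (j l)",
      OF finite_atLeastAtMost]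
    by (simp add: centered_entry_def)
  then show ?thesis by (simp only: haar_integral_sym_sum)
qed

section \<open>The centered Weingarten function as a sum over subsets\<close>

lemma sum_binomial_eq_sum_Pow:
  fixes F :: "nat \<Rightarrow> real"
  assumes "finite D"
  shows "(\<Sum>i = 0..card D. real (card D choose i) * F i) = (\<Sum>T\<in>Pow D. F (card T))"
proof -
  have "(\<Sum>T\<in>Pow D. F (card T)) = (\<Sum>i\<in>{0..card D}. \<Sum>T | T \<in> Pow D \<and> card T = i. F (card T))"
    using assms by (intro sum.group[symmetric]) (auto intro: card_mono)
  also have "\<dots> = (\<Sum>i = 0..card D. real (card D choose i) * F i)"
    using n_subsets[OF assms] by (intro sum.cong) auto
  finally show ?thesis ..
qed

lemma refines_meet_iff:
  assumes "partition_on {1..k} \<pi>" "partition_on {1..k} \<sigma>" "partition_on {1..k} \<tau>"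
  shows "refines {1..k} \<pi> (\<sigma> \<sqinter>\<^bsub>partition_lattice k\<^esub> \<tau>) \<longleftrightarrow>
    refines {1..k} \<pi> \<sigma> \<and> refines {1..k} \<pi> \<tau>"
proof -
  interpret complete_lattice "partition_lattice k" by (rule complete_lattice_partition_lattice)
  have carr: "\<pi> \<in> carrier (partition_lattice k)" "\<sigma> \<in> carrier (partition_lattice k)"
    "\<tau> \<in> carrier (partition_lattice k)"
    using assms by (simp_all add: partition_lattice_def)
  have le: "x \<sqsubseteq>\<^bsub>partition_lattice k\<^esub> y \<longleftrightarrow> refines {1..k} x y" for x y
    by (simp add: partition_lattice_def)
  have lb: "refines {1..k} (\<sigma> \<sqinter>\<^bsub>partition_lattice k\<^esub> \<tau>) \<sigma>"
    "refines {1..k} (\<sigma> \<sqinter>\<^bsub>partition_lattice k\<^esub> \<tau>) \<tau>"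
    using meet_left[OF carr(2,3)] meet_right[OF carr(2,3)] by (simp_all add: le)
  show ?thesis
    using refines_trans[OF _ lb(1)] refines_trans[OF _ lb(2)] meet_le[OF _ _ carr(2,3,1)] unfolding le
    by blast
qed

text \<open>If \<open>{x}\<close> is a block of \<open>\<sigma>\<close> and of \<open>\<tau>\<close>, then the two-block partition into \<open>{x}\<close> and its complement is
  an upper bound of both, hence of their join, which therefore cannot merge \<open>x\<close> with another point.\<close>

lemma mem_singleton_elems_join_iff:
  assumes \<sigma>: "partition_on {1..k} \<sigma>" and \<tau>: "partition_on {1..k} \<tau>"
  shows "x \<in> singleton_elems k (\<sigma> \<squnion>\<^bsub>partition_lattice k\<^esub> \<tau>) \<longleftrightarrow>
    x \<in> singleton_elems k \<sigma> \<and> x \<in> singleton_elems k \<tau>"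
proof -
  interpret complete_lattice "partition_lattice k" by (rule complete_lattice_partition_lattice)
  let ?J = "\<sigma> \<squnion>\<^bsub>partition_lattice k\<^esub> \<tau>"
  have carr: "\<sigma> \<in> carrier (partition_lattice k)" "\<tau> \<in> carrier (partition_lattice k)"
    using assms by (simp_all add: partition_lattice_def)
  have le: "x \<sqsubseteq>\<^bsub>partition_lattice k\<^esub> y \<longleftrightarrow> refines {1..k} x y" for x y
    by (simp add: partition_lattice_def)
  have ub: "refines {1..k} \<sigma> ?J" "refines {1..k} \<tau> ?J"
    using join_left[OF carr] join_right[OF carr] by (simp_all add: le)
  \<comment> \<open>a singleton block stays one in every refinement\<close>
  have down: "{x} \<in> P" if "refines {1..k} P Q" "{x} \<in> Q" for P Q
  proof -
    have "partition_on {x} {p \<in> P. p \<subseteq> {x}}" by (rule refines_obtains_subset[OF that])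
    then show ?thesis by (auto simp: partition_on_def subset_singleton_iff)
  qed
  show ?thesis
  proof
    assume "x \<in> singleton_elems k ?J"
    then show "x \<in> singleton_elems k \<sigma> \<and> x \<in> singleton_elems k \<tau>"
      using down ub by (auto simp: singleton_elems_def)
  next
    assume x: "x \<in> singleton_elems k \<sigma> \<and> x \<in> singleton_elems k \<tau>"
    let ?Q = "{{x}, {1..k} - {x}} - {{}}"
    have Q: "partition_on {1..k} ?Q"
      by (rule partition_onI) (use x in \<open>auto simp: singleton_elems_def disjnt_def\<close>)
    have up: "refines {1..k} P ?Q" if P: "partition_on {1..k} P" "{x} \<in> P" for P
    proof -
      have "\<exists>Y\<in>?Q. B \<subseteq> Y" if B: "B \<in> P" for B
      proof (cases "x \<in> B")
        case True
        then have "B = {x}" using block_eqI[OF P(1) B P(2)] by blast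
        then show ?thesis by auto
      next
        case False
        moreover have "B \<noteq> {}" "B \<subseteq> {1..k}" using P B by (auto simp: partition_on_def)
        ultimately show ?thesis by (intro bexI[of _ "{1..k} - {x}"]) auto
      qed
      then show ?thesis using P Q by (simp add: refines_def)
    qed
    have "refines {1..k} ?J ?Q"
      using join_le[of \<sigma> ?Q \<tau>] carr up assms x Q
      by (auto simp: le singleton_elems_def partition_lattice_def)
    then show "x \<in> singleton_elems k ?J"
      using down[of ?J ?Q] x by (auto simp: singleton_elems_def)
  qed
qed

text \<open>The restriction of \<open>\<pi>\<close> to \<open>\<pi> \<le> \<sigma> \<and> \<tau>\<close> is implicit in the Moebius factors, and the \<open>i\<close>-th term of the
  binomial sum is shared by the \<open>i\<close>-element subsets \<open>T\<close> of the singleton blocks of the join.\<close>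

lemma centered_Wg_eq_sum_subsets:
  assumes \<sigma>: "partition_on {1..k} \<sigma>" and \<tau>: "partition_on {1..k} \<tau>"
  shows "centered_Wg k \<sigma> \<tau> N =
    (\<Sum>T\<in>Pow {1..k}. if T \<subseteq> singleton_elems k \<sigma> \<and> T \<subseteq> singleton_elems k \<tau>
      then (- (1 / real N)) ^ card T * (\<Sum>\<pi> | partition_on {1..k} \<pi>.
        moebius k \<pi> \<sigma> * moebius k \<pi> \<tau> * (1 / falling_factorial (real N) (card \<pi> - card T)))
      else 0)"
proof -
  let ?D = "singleton_elems k (\<sigma> \<squnion>\<^bsub>partition_lattice k\<^esub> \<tau>)"
  let ?I = "\<lambda>n. (- (1 / real N)) ^ n * (\<Sum>\<pi> | partition_on {1..k} \<pi>.
        moebius k \<pi> \<sigma> * moebius k \<pi> \<tau> * (1 / falling_factorial (real N) (card \<pi> - n)))"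
  have D: "?D \<subseteq> {1..k}" by (auto simp: singleton_elems_def)
  have fin: "finite ?D" using D finite_subset by blast
  have inner: "(- 1) ^ n * (\<Sum>\<pi> | partition_on {1..k} \<pi> \<and>
      refines {1..k} \<pi> (\<sigma> \<sqinter>\<^bsub>partition_lattice k\<^esub> \<tau>).
      moebius k \<pi> \<sigma> * moebius k \<pi> \<tau> * real N powi (- int n)
        * (1 / falling_factorial (real N) (card \<pi> - n))) = ?I n" for n
  proof -
    have "(\<Sum>\<pi> | partition_on {1..k} \<pi> \<and> refines {1..k} \<pi> (\<sigma> \<sqinter>\<^bsub>partition_lattice k\<^esub> \<tau>).
        moebius k \<pi> \<sigma> * moebius k \<pi> \<tau> * real N powi (- int n)
        * (1 / falling_factorial (real N) (card \<pi> - n))) =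
      (\<Sum>\<pi> | partition_on {1..k} \<pi>. moebius k \<pi> \<sigma> * moebius k \<pi> \<tau> * real N powi (- int n)
        * (1 / falling_factorial (real N) (card \<pi> - n)))"
      using refines_meet_iff[OF _ \<sigma> \<tau>]
      by (intro sum.mono_neutral_left) (auto simp: finitely_many_partition_on moebius_def)
    also have "\<dots> = (1 / real N) ^ n * (\<Sum>\<pi> | partition_on {1..k} \<pi>.
        moebius k \<pi> \<sigma> * moebius k \<pi> \<tau> * (1 / falling_factorial (real N) (card \<pi> - n)))"
      unfolding sum_distrib_left
      by (intro sum.cong) (simp_all add: power_int_minus power_one_over divide_simps)
    finally show ?thesis
      by (simp only: power_minus[of "1 / real N"] mult.assoc)
  qed
  have "centered_Wg k \<sigma> \<tau> N = (\<Sum>n = 0..card ?D. real (card ?D choose n) * ?I n)"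
    unfolding centered_Wg_def Let_def mult.assoc[of "real _"] inner ..
  also have "\<dots> = (\<Sum>T\<in>Pow ?D. ?I (card T))"
    by (rule sum_binomial_eq_sum_Pow[OF fin])
  also have "\<dots> = (\<Sum>T\<in>{T \<in> Pow {1..k}. T \<subseteq> singleton_elems k \<sigma> \<and> T \<subseteq> singleton_elems k \<tau>}.
      ?I (card T))"
    using mem_singleton_elems_join_iff[OF \<sigma> \<tau>] D by (intro sum.cong) blast+
  also have "\<dots> = (\<Sum>T\<in>Pow {1..k}. if T \<subseteq> singleton_elems k \<sigma> \<and> T \<subseteq> singleton_elems k \<tau>
      then ?I (card T) else 0)"
    by (rule sum.inter_filter) simp
  finally show ?thesis .
qed

section \<open>Multi-indices with isolated positions\<close>

text \<open>Values of multi-indices lie in \<open>{1..N}\<close>, so for \<open>l \<ge> 1\<close> the values \<open>N + l\<close> are new and pairwise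
  distinct: the positions in \<open>T\<close> become singleton blocks of the index partition, and the coincidences
  outside \<open>T\<close> are kept.\<close>

definition isolate :: "nat \<Rightarrow> nat set \<Rightarrow> (nat \<Rightarrow> nat) \<Rightarrow> nat \<Rightarrow> nat" where
  "isolate N T h l = (if l \<in> T then N + l else h l)"

lemma isolate_eq_iff:
  assumes "\<And>l. l \<in> {1..k} \<Longrightarrow> h l \<in> {1..N}" and l: "l \<in> {1..k}" "m \<in> {1..k}"
  shows "isolate N T h l = isolate N T h m \<longleftrightarrow> l = m \<or> l \<notin> T \<and> m \<notin> T \<and> h l = h m"
  using assms(1)[OF l(1)] assms(1)[OF l(2)] l by (auto simp: isolate_def)

lemma monochromatic_isolate_iff:
  assumes \<sigma>: "partition_on {1..k} \<sigma>" and T: "T \<subseteq> {1..k}"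
    and h: "\<And>l. l \<in> {1..k} \<Longrightarrow> h l \<in> {1..N}"
  shows "monochromatic (isolate N T h) \<sigma> \<longleftrightarrow> T \<subseteq> singleton_elems k \<sigma> \<and> monochromatic h \<sigma>"
proof -
  have sub: "x \<in> {1..k}" if "B \<in> \<sigma>" "x \<in> B" for B x
    using that partition_onD1[OF \<sigma>] by (metis UnionI)
  have eq_iff: "isolate N T h x = isolate N T h y \<longleftrightarrow> x = y \<or> x \<notin> T \<and> y \<notin> T \<and> h x = h y"
    if "B \<in> \<sigma>" "x \<in> B" "y \<in> B" for B x y
    using isolate_eq_iff[of k h N, OF h] sub that by metis
  show ?thesis
  proof
    assume mono: "monochromatic (isolate N T h) \<sigma>"
    have iso: "x = y \<or> x \<notin> T \<and> y \<notin> T \<and> h x = h y" if "B \<in> \<sigma>" "x \<in> B" "y \<in> B" for B x y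
      using monochromaticD[OF mono that] eq_iff[OF that] by simp
    have "t \<in> singleton_elems k \<sigma>" if t: "t \<in> T" for t
    proof -
      have tk: "t \<in> {1..k}" using t T by blast
      then obtain B where B: "B \<in> \<sigma>" "t \<in> B" using partition_onD1[OF \<sigma>] by (metis UnionE)
      then have "B = {t}" using iso[OF B] t by blast
      then show ?thesis using B(1) tk by (simp add: singleton_elems_def)
    qed
    moreover have "monochromatic h \<sigma>"
    proof (rule monochromaticI)
      fix B x y assume "B \<in> \<sigma>" "x \<in> B" "y \<in> B"
      then show "h x = h y" using iso by metis
    qed
    ultimately show "T \<subseteq> singleton_elems k \<sigma> \<and> monochromatic h \<sigma>" by blast
  next
    assume *: "T \<subseteq> singleton_elems k \<sigma> \<and> monochromatic h \<sigma>"
    have single: "B = {t}" if "B \<in> \<sigma>" "t \<in> B" "t \<in> T" for B t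
    proof -
      have "{t} \<in> \<sigma>" using * that(3) by (auto simp: singleton_elems_def)
      then show ?thesis using block_eqI[OF \<sigma> that(1) _ that(2)] by blast
    qed
    show "monochromatic (isolate N T h) \<sigma>"
    proof (rule monochromaticI)
      fix B x y assume B: "B \<in> \<sigma>" "x \<in> B" "y \<in> B"
      have "x = y \<or> x \<notin> T \<and> y \<notin> T" using single[OF B(1)] B(2,3) by blast
      then show "isolate N T h x = isolate N T h y"
        using eq_iff[OF B] monochromaticD[of h \<sigma>, OF _ B] * by blast
    qed
  qed
qed

lemma zeta_isolate:
  assumes \<sigma>: "partition_on {1..k} \<sigma>" and "T \<subseteq> {1..k}"
    and "\<And>l. l \<in> {1..k} \<Longrightarrow> h l \<in> {1..N}"
  shows "zeta k \<sigma> (index_partition k (isolate N T h)) =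
    (if T \<subseteq> singleton_elems k \<sigma> then zeta k \<sigma> (index_partition k h) else 0)"
  unfolding zeta_def refines_index_partition_iff[OF \<sigma>]
  using monochromatic_isolate_iff[OF assms] by simp

lemma card_index_partition: "card (index_partition k h) = card (h ` {1..k})"
proof -
  have "index_partition k h = (\<lambda>c. {m \<in> {1..k}. h m = c}) ` h ` {1..k}"
    by (simp add: index_partition_def image_image)
  moreover have "inj_on (\<lambda>c. {m \<in> {1..k}. h m = c}) (h ` {1..k})"
    by (rule inj_onI) blast
  ultimately show ?thesis by (simp add: card_image)
qed

text \<open>The truncated subtraction is exact, because the positions in \<open>T\<close> contribute \<open>card T\<close> singleton blocks.
  The result is the number of values prescribed by the moment over the complement of \<open>T\<close>.\<close>

lemma card_index_partition_isolate:
  assumes T: "T \<subseteq> {1..k}" and h: "\<And>l. l \<in> {1..k} \<Longrightarrow> h l \<in> {1..N}"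
  shows "card (index_partition k (isolate N T h)) - card T = card (h ` ({1..k} - T))"
proof -
  have fin: "finite T" using T finite_subset by blast
  have "isolate N T h ` {1..k} = isolate N T h ` (T \<union> ({1..k} - T))"
    using T by (simp add: Un_absorb1)
  also have "\<dots> = (+) N ` T \<union> h ` ({1..k} - T)"
    unfolding image_Un by (intro arg_cong2[of _ _ _ _ "(\<union>)"] image_cong) (auto simp: isolate_def)
  finally have "isolate N T h ` {1..k} = (+) N ` T \<union> h ` ({1..k} - T)" .
  moreover have "(+) N ` T \<inter> h ` ({1..k} - T) = {}"
    using T h by fastforce
  ultimately have "card (isolate N T h ` {1..k}) = card T + card (h ` ({1..k} - T))"
    using fin by (simp add: card_Un_disjoint card_image)
  then show ?thesis by (simp add: card_index_partition)
qed

lemma index_partition_eq_iff: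
  "index_partition k g = index_partition k h \<longleftrightarrow>
    (\<forall>l\<in>{1..k}. \<forall>m\<in>{1..k}. g l = g m \<longleftrightarrow> h l = h m)"
proof
  have same: "f l = f m \<longleftrightarrow> (\<exists>B\<in>index_partition k f. l \<in> B \<and> m \<in> B)"
    if "l \<in> {1..k}" "m \<in> {1..k}" for f l m
    using that by (auto simp: index_partition_def)
  assume "index_partition k g = index_partition k h"
  then show "\<forall>l\<in>{1..k}. \<forall>m\<in>{1..k}. g l = g m \<longleftrightarrow> h l = h m"
    using same[where f = g] same[where f = h] by metis
next
  assume "\<forall>l\<in>{1..k}. \<forall>m\<in>{1..k}. g l = g m \<longleftrightarrow> h l = h m"
  then show "index_partition k g = index_partition k h"
    unfolding index_partition_def by (intro image_cong Collect_cong) auto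
qed

lemma index_partition_isolate_eq_iff:
  assumes i: "\<And>l. l \<in> {1..k} \<Longrightarrow> i l \<in> {1..N}" and j: "\<And>l. l \<in> {1..k} \<Longrightarrow> j l \<in> {1..N}"
  shows "index_partition k (isolate N T i) = index_partition k (isolate N T j) \<longleftrightarrow>
    (\<forall>l\<in>{1..k} - T. \<forall>m\<in>{1..k} - T. i l = i m \<longleftrightarrow> j l = j m)"
proof -
  have "isolate N T h l = isolate N T h m \<longleftrightarrow> l = m \<or> l \<notin> T \<and> m \<notin> T \<and> h l = h m"
    if "\<And>l. l \<in> {1..k} \<Longrightarrow> h l \<in> {1..N}" "l \<in> {1..k}" "m \<in> {1..k}" for h l m
    using isolate_eq_iff[of k h N l m T] that by blast
  note isol = this[of i, OF i] this[of j, OF j]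
  show ?thesis
    unfolding index_partition_eq_iff using isol by blast
qed

section \<open>The centered Weingarten formula\<close>

theorem theorem3p1:
  fixes k N :: nat and i j :: "nat \<Rightarrow> nat"
  assumes "k \<ge> 1"
    and "\<And>l. l \<in> {1..k} \<Longrightarrow> i l \<in> {1..N}"
    and "\<And>l. l \<in> {1..k} \<Longrightarrow> j l \<in> {1..N}"
  shows "haar_integral_sym N (\<lambda>g. \<Prod>l = 1..k. centered_entry N g (i l) (j l)) =
    (\<Sum>\<sigma> | partition_on {1..k} \<sigma>. \<Sum>\<tau> | partition_on {1..k} \<tau>.
       centered_Wg k \<sigma> \<tau> N * zeta k \<sigma> (index_partition k i) * zeta k \<tau> (index_partition k j))"
proof -
  let ?P = "{\<pi>. partition_on {1..k} \<pi>}"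
  let ?c = "\<lambda>T \<pi>. 1 / falling_factorial (real N) (card \<pi> - card T)"
  let ?a = "\<lambda>T. (- (1 / real N)) ^ card T"
  let ?zi = "\<lambda>T \<sigma>. zeta k \<sigma> (index_partition k (isolate N T i))"
  let ?zj = "\<lambda>T \<tau>. zeta k \<tau> (index_partition k (isolate N T j))"
  have finP: "finite ?P" by (simp add: finitely_many_partition_on)
  \<comment> \<open>isolating \<open>T\<close> in both multi-indices makes each summand a product of a factor in \<open>\<sigma>\<close> and one in \<open>\<tau>\<close>\<close>
  have Wg: "centered_Wg k \<sigma> \<tau> N * zeta k \<sigma> (index_partition k i) * zeta k \<tau> (index_partition k j) =
      (\<Sum>T\<in>Pow {1..k}. ?a T * (\<Sum>\<pi>\<in>?P. ?c T \<pi> *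
        ((moebius k \<pi> \<sigma> * ?zi T \<sigma>) * (moebius k \<pi> \<tau> * ?zj T \<tau>))))"
    if \<sigma>: "\<sigma> \<in> ?P" and \<tau>: "\<tau> \<in> ?P" for \<sigma> \<tau>
  proof -
    have "(if T \<subseteq> singleton_elems k \<sigma> \<and> T \<subseteq> singleton_elems k \<tau>
        then ?a T * (\<Sum>\<pi>\<in>?P. moebius k \<pi> \<sigma> * moebius k \<pi> \<tau> * ?c T \<pi>) else 0) *
        zeta k \<sigma> (index_partition k i) * zeta k \<tau> (index_partition k j) =
      ?a T * (\<Sum>\<pi>\<in>?P. ?c T \<pi> * ((moebius k \<pi> \<sigma> * ?zi T \<sigma>) * (moebius k \<pi> \<tau> * ?zj T \<tau>)))"
      if "T \<in> Pow {1..k}" for T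
      using zeta_isolate[of k \<sigma> T i N] zeta_isolate[of k \<tau> T j N] that \<sigma> \<tau> assms(2,3)
      by (simp add: sum_distrib_left sum_distrib_right mult_ac)
    then show ?thesis
      using \<sigma> \<tau> by (simp add: centered_Wg_eq_sum_subsets sum_distrib_right)
  qed
  have "(\<Sum>\<sigma>\<in>?P. \<Sum>\<tau>\<in>?P.
      centered_Wg k \<sigma> \<tau> N * zeta k \<sigma> (index_partition k i) * zeta k \<tau> (index_partition k j)) =
    (\<Sum>\<sigma>\<in>?P. \<Sum>\<tau>\<in>?P. \<Sum>T\<in>Pow {1..k}. ?a T * (\<Sum>\<pi>\<in>?P. ?c T \<pi> *
        ((moebius k \<pi> \<sigma> * ?zi T \<sigma>) * (moebius k \<pi> \<tau> * ?zj T \<tau>))))"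
    using Wg by (intro sum.cong refl) blast
  also have "\<dots> = (\<Sum>T\<in>Pow {1..k}. \<Sum>\<sigma>\<in>?P. \<Sum>\<tau>\<in>?P. ?a T * (\<Sum>\<pi>\<in>?P. ?c T \<pi> *
        ((moebius k \<pi> \<sigma> * ?zi T \<sigma>) * (moebius k \<pi> \<tau> * ?zj T \<tau>))))"
    unfolding sum.swap[of _ "Pow {1..k}"] ..
  also have "\<dots> = (\<Sum>T\<in>Pow {1..k}. ?a T * (\<Sum>\<sigma>\<in>?P. \<Sum>\<tau>\<in>?P. \<Sum>\<pi>\<in>?P. ?c T \<pi> *
        ((moebius k \<pi> \<sigma> * ?zi T \<sigma>) * (moebius k \<pi> \<tau> * ?zj T \<tau>))))"
    by (simp only: sum_distrib_left)
  also have "\<dots> = (\<Sum>T\<in>Pow {1..k}. ?a T * (\<Sum>\<pi>\<in>?P. ?c T \<pi> *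
        ((\<Sum>\<sigma>\<in>?P. moebius k \<pi> \<sigma> * ?zi T \<sigma>) * (\<Sum>\<tau>\<in>?P. moebius k \<pi> \<tau> * ?zj T \<tau>))))"
  proof (rule sum.cong[OF refl], rule arg_cong2[where f = "(*)", OF refl])
    fix T
    let ?t = "\<lambda>\<sigma> \<tau> \<pi>. ?c T \<pi> * ((moebius k \<pi> \<sigma> * ?zi T \<sigma>) * (moebius k \<pi> \<tau> * ?zj T \<tau>))"
    have "(\<Sum>\<sigma>\<in>?P. \<Sum>\<tau>\<in>?P. \<Sum>\<pi>\<in>?P. ?t \<sigma> \<tau> \<pi>) = (\<Sum>\<sigma>\<in>?P. \<Sum>\<pi>\<in>?P. \<Sum>\<tau>\<in>?P. ?t \<sigma> \<tau> \<pi>)"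
      by (intro sum.cong refl sum.swap)
    also have "\<dots> = (\<Sum>\<pi>\<in>?P. \<Sum>\<sigma>\<in>?P. \<Sum>\<tau>\<in>?P. ?t \<sigma> \<tau> \<pi>)"
      by (rule sum.swap)
    finally show "(\<Sum>\<sigma>\<in>?P. \<Sum>\<tau>\<in>?P. \<Sum>\<pi>\<in>?P. ?t \<sigma> \<tau> \<pi>) = (\<Sum>\<pi>\<in>?P. ?c T \<pi> *
        ((\<Sum>\<sigma>\<in>?P. moebius k \<pi> \<sigma> * ?zi T \<sigma>) * (\<Sum>\<tau>\<in>?P. moebius k \<pi> \<tau> * ?zj T \<tau>)))"
      unfolding sum_product unfolding sum_distrib_left .
  qed
  \<comment> \<open>by Moebius inversion only \<open>\<pi> = \<Pi>\<^bsub>i\<^sub>T\<^esub> = \<Pi>\<^bsub>j\<^sub>T\<^esub>\<close> contributes\<close>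
  also have "\<dots> = (\<Sum>T\<in>Pow {1..k}. ?a T *
      (if index_partition k (isolate N T i) = index_partition k (isolate N T j)
       then ?c T (index_partition k (isolate N T i)) else 0))"
  proof (rule sum.cong[OF refl], rule arg_cong2[where f = "(*)", OF refl])
    fix T
    let ?i = "index_partition k (isolate N T i)" and ?j = "index_partition k (isolate N T j)"
    have "(\<Sum>\<pi>\<in>?P. ?c T \<pi> *
        ((\<Sum>\<sigma>\<in>?P. moebius k \<pi> \<sigma> * ?zi T \<sigma>) * (\<Sum>\<tau>\<in>?P. moebius k \<pi> \<tau> * ?zj T \<tau>))) =
      (\<Sum>\<pi>\<in>?P. if \<pi> = ?i then (if ?i = ?j then ?c T ?i else 0) else 0)"
    proof (rule sum.cong[OF refl])
      fix \<pi> assume "\<pi> \<in> ?P"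
      then have \<pi>: "partition_on {1..k} \<pi>" by simp
      show "?c T \<pi> *
        ((\<Sum>\<sigma>\<in>?P. moebius k \<pi> \<sigma> * ?zi T \<sigma>) * (\<Sum>\<tau>\<in>?P. moebius k \<pi> \<tau> * ?zj T \<tau>)) =
        (if \<pi> = ?i then (if ?i = ?j then ?c T ?i else 0) else 0)"
        unfolding sum_moebius_zeta[OF \<pi>] by simp
    qed
    also have "\<dots> = (if ?i = ?j then ?c T ?i else 0)"
      using finP partition_on_index_partition[of k "isolate N T i"] by (simp add: sum.delta)
    finally show "(\<Sum>\<pi>\<in>?P. ?c T \<pi> *
        ((\<Sum>\<sigma>\<in>?P. moebius k \<pi> \<sigma> * ?zi T \<sigma>) * (\<Sum>\<tau>\<in>?P. moebius k \<pi> \<tau> * ?zj T \<tau>))) =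
      (if ?i = ?j then ?c T ?i else 0)" .
  qed
  also have "\<dots> = (\<Sum>T\<in>Pow {1..k}. ?a T *
      haar_integral_sym N (\<lambda>g. \<Prod>l\<in>{1..k} - T. perm_matrix_entry g (i l) (j l)))"
  proof (rule sum.cong[OF refl], rule arg_cong2[where f = "(*)", OF refl])
    fix T assume "T \<in> Pow {1..k}"
    then have T: "T \<subseteq> {1..k}" by simp
    have fin: "finite ({1..k} - T)" and "i ` ({1..k} - T) \<subseteq> {1..N}" "j ` ({1..k} - T) \<subseteq> {1..N}"
      using assms(2,3) by auto
    note moment = haar_integral_prod_perm_matrix_entry[OF this]
    have iff: "index_partition k (isolate N T i) = index_partition k (isolate N T j) \<longleftrightarrow>
        (\<forall>l\<in>{1..k} - T. \<forall>m\<in>{1..k} - T. i l = i m \<longleftrightarrow> j l = j m)"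
      by (rule index_partition_isolate_eq_iff) (fact assms(2,3))+
    have card: "card (index_partition k (isolate N T i)) - card T = card (i ` ({1..k} - T))"
      by (rule card_index_partition_isolate) (fact T assms(2))+
    show "(if index_partition k (isolate N T i) = index_partition k (isolate N T j)
       then ?c T (index_partition k (isolate N T i)) else 0) =
      haar_integral_sym N (\<lambda>g. \<Prod>l\<in>{1..k} - T. perm_matrix_entry g (i l) (j l))"
      unfolding moment iff card ..
  qed
  finally show ?thesis unfolding haar_integral_prod_centered_entry by simp
qed

end
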